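(* Every feckly zero-adequate ring is an elementary divisor ring.
   Context: All rings are commutative with identity. $J(R)$ denotes the Jacobson radical of $R$. A ring is a Bézout ring if every finitely generated ideal is principal. An element $c\in R$ is feckly adequate if for every $a\in R$ there exist $r,s\in R$ such that (i) $c\equiv rs \pmod{J(R)}$; (ii) $rR+aR=R$; (iii) $s'R+aR\neq R$ for each non-invertible divisor $s'$ of $s$ (i.e. each non-unit $s'\in R$ with $s\in s'R$). A feckly zero-adequate ring is a Bézout ring $R$ in which $0\in R$ is feckly adequate. A matrix $A$ (not necessarily square) over $R$ admits diagonal reduction if there exist invertible matrices $P$ and $Q$ over $R$ such that $PAQ=(d_{ij})$ is a diagonal matrix with $d_{ii}$ a divisor of $d_{(i+1)(i+1)}$ for each $i$. A ring $R$ is an elementary divisor ring if every matrix over $R$ admits diagonal reduction. *)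

theory Defs
  imports "Jordan_Normal_Form.Matrix"
begin

text \<open>A ring is a type of class \<open>comm_ring_1\<close>. Its ideals are its submodules as a module over
  itself, so \<open>subspace\<close> and \<open>span\<close> of \<open>HOL.Modules\<close> give ideals and the ideal generated by a
  set. (The unqualified name \<open>module\<close> denotes the HOL-Algebra locale here.)\<close>

lemma module_times: "Modules.module ((*) :: 'a::comm_ring_1 \<Rightarrow> 'a \<Rightarrow> 'a)"
  by unfold_locales (simp_all add: algebra_simps)

abbreviation ring_ideal :: "'a::comm_ring_1 set \<Rightarrow> bool"
  where "ring_ideal \<equiv> Modules.module.subspace (*)"

abbreviation ideal_gen :: "'a::comm_ring_1 set \<Rightarrow> 'a set"
  where "ideal_gen \<equiv> Modules.module.span (*)"

definition maximal_ring_ideal :: "'a::comm_ring_1 set \<Rightarrow> bool" where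
  "maximal_ring_ideal M \<longleftrightarrow> ring_ideal M \<and> M \<noteq> UNIV \<and>
     (\<forall>I. ring_ideal I \<and> M \<subseteq> I \<longrightarrow> I = M \<or> I = UNIV)"

definition jacobson_radical :: "'a::comm_ring_1 set" where
  "jacobson_radical = \<Inter> {M. maximal_ring_ideal M}"

definition bezout_ring :: "'a::comm_ring_1 itself \<Rightarrow> bool" where
  "bezout_ring _ \<longleftrightarrow>
     (\<forall>S :: 'a set. finite S \<longrightarrow> (\<exists>d. ideal_gen S = ideal_gen {d}))"

text \<open>\<open>ideal_gen {x, a} = UNIV\<close> renders \<open>xR + aR = R\<close>.\<close>

definition feckly_adequate :: "'a::comm_ring_1 \<Rightarrow> bool" where
  "feckly_adequate c \<longleftrightarrow>
     (\<forall>a. \<exists>r s. c - r * s \<in> jacobson_radical \<and>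
        ideal_gen {r, a} = UNIV \<and>
        (\<forall>s'. s' dvd s \<and> \<not> s' dvd 1 \<longrightarrow> ideal_gen {s', a} \<noteq> UNIV))"

definition feckly_zero_adequate_ring :: "'a::comm_ring_1 itself \<Rightarrow> bool" where
  "feckly_zero_adequate_ring _ \<longleftrightarrow>
     bezout_ring TYPE('a) \<and> feckly_adequate (0 :: 'a)"

definition admits_diagonal_reduction :: "'a::comm_ring_1 mat \<Rightarrow> bool" where
  "admits_diagonal_reduction A \<longleftrightarrow>
     (\<exists>P Q. P \<in> carrier_mat (dim_row A) (dim_row A) \<and> invertible_mat P \<and>
        Q \<in> carrier_mat (dim_col A) (dim_col A) \<and> invertible_mat Q \<and>
        diagonal_mat (P * A * Q) \<and>
        (\<forall>i. Suc i < min (dim_row A) (dim_col A) \<longrightarrow>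
           (P * A * Q) $$ (i, i) dvd (P * A * Q) $$ (Suc i, Suc i)))"

definition elementary_divisor_ring :: "'a::comm_ring_1 itself \<Rightarrow> bool" where
  "elementary_divisor_ring _ \<longleftrightarrow> (\<forall>A :: 'a mat. admits_diagonal_reduction A)"

end

theory Submission
  imports Defs
begin

text \<open>Modulo its Jacobson radical, a feckly zero-adequate ring is von Neumann regular, hence of stable
  range one, and stable range one lifts along the radical. In a Bezout ring of stable range one, any
  \<open>a\<close>, \<open>b\<close> have a greatest common divisor of the form \<open>a + b z\<close>. By induction on the rows of a
  matrix \<open>A\<close>, this yields a combination of the rows, with coefficient 1 at the first row, that has
  the same common divisors as \<open>A\<close>; combining its entries in the same way gives a single element
  dividing every entry of \<open>A\<close>. Transvections move it to the corner, its row and column are cleared,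
  and the argument is repeated on the remaining block.\<close>

section \<open>Stable range one\<close>

lemma ideal_gen_pair:
  "c \<in> ideal_gen {a, b} \<longleftrightarrow> (\<exists>x y. c = x * a + y * b)" for a b c :: "'a::comm_ring_1"
  unfolding Modules.module.span_insert[OF module_times, of a "{b}"]
    Modules.module.span_singleton[OF module_times]
  by (auto simp: image_iff diff_eq_eq add.commute)

lemma ideal_gen_pair_eq_UNIV:
  "ideal_gen {a, b} = UNIV \<longleftrightarrow> (\<exists>x y. x * a + y * b = 1)" for a b :: "'a::comm_ring_1"
proof
  assume "ideal_gen {a, b} = UNIV"
  then show "\<exists>x y. x * a + y * b = 1"
    using ideal_gen_pair[of 1 a b] by force
next
  assume "\<exists>x y. x * a + y * b = 1"
  then obtain x y where xy: "x * a + y * b = 1" by blast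
  have "c \<in> ideal_gen {a, b}" for c
    unfolding ideal_gen_pair
  proof (intro exI)
    have "c = c * (x * a + y * b)" by (simp add: xy)
    then show "c = (c * x) * a + (c * y) * b" by (simp add: algebra_simps)
  qed
  then show "ideal_gen {a, b} = UNIV" by blast
qed

lemma bezout_ring_gcd:
  fixes a b :: "'a::comm_ring_1"
  assumes "bezout_ring TYPE('a)"
  obtains d x y where "d dvd a" "d dvd b" "d = x * a + y * b"
proof -
  obtain d where d: "ideal_gen {a, b} = ideal_gen {d}"
    using assms unfolding bezout_ring_def by (meson finite.emptyI finite.insertI)
  have sub: "{a, b} \<subseteq> ideal_gen {d}" "d \<in> ideal_gen {a, b}"
    using Modules.module.span_superset[OF module_times, of "{a, b}"]
      Modules.module.span_superset[OF module_times, of "{d}"] d by auto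
  from sub(1) have "d dvd a" "d dvd b"
    unfolding Modules.module.span_singleton[OF module_times] by auto
  with sub(2) that show thesis unfolding ideal_gen_pair by blast
qed

section \<open>Maximal ideals: detection of units, comaximality, primality\<close>

lemma ring_ideal_iff:
  "ring_ideal I \<longleftrightarrow> 0 \<in> I \<and> (\<forall>x\<in>I. \<forall>y\<in>I. x + y \<in> I) \<and> (\<forall>c. \<forall>x\<in>I. c * x \<in> I)"
  for I :: "'a::comm_ring_1 set"
  by (rule Modules.module.subspace_def[OF module_times])

lemma ring_ideal_one_mem:
  assumes "ring_ideal I" "(1::'a::comm_ring_1) \<in> I"
  shows "I = UNIV"
  using assms by (metis UNIV_eq_I mult.right_neutral ring_ideal_iff)

text \<open>Zorn's lemma on the ideals that contain \<open>x\<close> and avoid 1, a condition that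
  passes to unions of chains. Units can thus be tested at maximal ideals, and the quotient by
  \<open>J(R)\<close> is never formed.\<close>

lemma nonunit_in_maximal_ring_ideal:
  fixes x :: "'a::comm_ring_1"
  assumes "\<not> x dvd 1"
  obtains M where "maximal_ring_ideal M" "x \<in> M"
proof -
  let ?F = "{I. ring_ideal I \<and> x \<in> I \<and> 1 \<notin> I}"
  have "ideal_gen {x} \<in> ?F"
    using assms Modules.module.subspace_span[OF module_times, of "{x}"]
      Modules.module.span_superset[OF module_times, of "{x}"]
    by (auto simp: Modules.module.span_singleton[OF module_times] dvd_def mult.commute)
  then have "?F \<noteq> {}" by blast
  moreover have "\<Union>C \<in> ?F" if ne: "C \<noteq> {}" and chain: "subset.chain ?F C" for C
  proof -
    from chain have C: "\<And>I. I \<in> C \<Longrightarrow> ring_ideal I \<and> x \<in> I \<and> 1 \<notin> I"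
      and ch: "\<And>I J. I \<in> C \<Longrightarrow> J \<in> C \<Longrightarrow> I \<subseteq> J \<or> J \<subseteq> I"
      by (auto simp: subset_chain_def)
    have "u + v \<in> \<Union>C" if uv: "u \<in> \<Union>C" "v \<in> \<Union>C" for u v
    proof -
      from uv obtain I J where IJ: "I \<in> C" "J \<in> C" "u \<in> I" "v \<in> J" by blast
      with ch[of I J] obtain K where "K \<in> C" "u \<in> K" "v \<in> K" by blast
      with C[of K] show ?thesis unfolding ring_ideal_iff by blast
    qed
    moreover have "c * u \<in> \<Union>C" if "u \<in> \<Union>C" for c u
    proof -
      from that obtain I where "I \<in> C" "u \<in> I" by blast
      with C[of I] show ?thesis unfolding ring_ideal_iff by blast
    qed
    moreover obtain I where "I \<in> C" using ne by blast
    then have "0 \<in> \<Union>C" "x \<in> \<Union>C" using C[of I] unfolding ring_ideal_iff by blast+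
    moreover have "1 \<notin> \<Union>C" using C by blast
    ultimately show ?thesis
      unfolding ring_ideal_iff by blast
  qed
  ultimately have "\<exists>M\<in>?F. \<forall>I\<in>?F. M \<subseteq> I \<longrightarrow> I = M"
    by (rule subset_Zorn_nonempty)
  then obtain M where M: "M \<in> ?F" and max: "\<forall>I\<in>?F. M \<subseteq> I \<longrightarrow> I = M" by blast
  have "maximal_ring_ideal M"
    unfolding maximal_ring_ideal_def
  proof (intro conjI allI impI)
    show "ring_ideal M" "M \<noteq> UNIV" using M by blast+
    fix I assume I: "ring_ideal I \<and> M \<subseteq> I"
    show "I = M \<or> I = UNIV"
    proof (cases "1 \<in> I")
      case True
      then show ?thesis using I ring_ideal_one_mem by metis
    next
      case False
      then have "I \<in> ?F" using I M by auto
      then show ?thesis using max I by metis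
    qed
  qed
  with M that show thesis by blast
qed

lemma maximal_ring_ideal_add:
  assumes "maximal_ring_ideal M" "x \<in> M" "y \<in> M"
  shows "x + y \<in> M"
  using assms by (simp add: maximal_ring_ideal_def ring_ideal_iff)

lemma maximal_ring_ideal_mult:
  assumes "maximal_ring_ideal M" "x \<in> M"
  shows "c * x \<in> M"
  using assms by (simp add: maximal_ring_ideal_def ring_ideal_iff)

text \<open>The ideal \<open>M + aR\<close> strictly contains \<open>M\<close>, so it is the whole
  ring: \<open>a\<close> is invertible modulo \<open>M\<close>, stated without the quotient
  field.\<close>

lemma maximal_ring_ideal_coprime:
  fixes a :: "'a::comm_ring_1"
  assumes "maximal_ring_ideal M" "a \<notin> M"
  obtains m z where "m \<in> M" "m + z * a = 1"
proof -
  have M: "ring_ideal M" and max: "\<And>I. ring_ideal I \<Longrightarrow> M \<subseteq> I \<Longrightarrow> I = M \<or> I = UNIV"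
    using assms unfolding maximal_ring_ideal_def by auto
  let ?I = "{m + z * a | m z. m \<in> M}"
  have "ring_ideal ?I"
    unfolding ring_ideal_iff
  proof (intro conjI ballI allI)
    show "0 \<in> ?I"
      using M by (auto simp: ring_ideal_iff intro!: exI[of _ 0])
  next
    fix x y assume "x \<in> ?I" "y \<in> ?I"
    then obtain m z m' z' where *: "m \<in> M" "m' \<in> M" "x = m + z * a" "y = m' + z' * a" by blast
    then have "x + y = (m + m') + (z + z') * a" by (simp add: algebra_simps)
    with * M show "x + y \<in> ?I" unfolding ring_ideal_iff by blast
  next
    fix c x assume "x \<in> ?I"
    then obtain m z where *: "m \<in> M" "x = m + z * a" by blast
    then have "c * x = c * m + (c * z) * a" by (simp add: algebra_simps)
    with * M show "c * x \<in> ?I" unfolding ring_ideal_iff by blast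
  qed
  moreover have "M \<subseteq> ?I"
  proof
    fix m assume "m \<in> M"
    moreover have "m = m + 0 * a" by simp
    ultimately show "m \<in> ?I" by blast
  qed
  moreover have "a \<in> ?I"
  proof -
    have "a = 0 + 1 * a" by simp
    moreover have "0 \<in> M" using M by (simp add: ring_ideal_iff)
    ultimately show ?thesis by blast
  qed
  ultimately have "?I = UNIV" using max assms(2) by blast
  then have "1 \<in> ?I" by blast
  then obtain m z where "m \<in> M" "1 = m + z * a" by blast
  with that show thesis by metis
qed

lemma maximal_ring_ideal_prime:
  fixes x y :: "'a::comm_ring_1"
  assumes M: "maximal_ring_ideal M" and xy: "x * y \<in> M" and "x \<notin> M"
  shows "y \<in> M"
proof -
  obtain m z where m: "m \<in> M" "m + z * x = 1"
    using maximal_ring_ideal_coprime[OF M \<open>x \<notin> M\<close>] .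
  have "y = (m + z * x) * y" by (simp add: m)
  also have "\<dots> = y * m + z * (x * y)" by (simp add: algebra_simps)
  also have "\<dots> \<in> M"
    by (intro maximal_ring_ideal_add[OF M] maximal_ring_ideal_mult[OF M] m(1) xy)
  finally show ?thesis .
qed

text \<open>Modulo \<open>J(R)\<close>, the elements \<open>r\<close> and \<open>s\<close> split the ring into a factor where \<open>r = 0\<close>
  and \<open>a\<close> is a unit, and a factor where \<open>a = 0\<close> and hence \<open>b\<close> and \<open>r\<close> are units. So \<open>r\<close> is the
  multiplier sought.\<close>

lemma stable_range_one:
  fixes a b :: "'a::comm_ring_1"
  assumes R: "feckly_zero_adequate_ring TYPE('a)" and ab: "x * a + y * b = 1"
  shows "\<exists>r. (a + b * r) dvd 1"
proof -
  have bez: "bezout_ring TYPE('a)" using R by (simp add: feckly_zero_adequate_ring_def)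
  from R obtain r s where "- (r * s) \<in> jacobson_radical"
    and ra: "ideal_gen {r, a} = UNIV"
    and s: "\<And>s'. s' dvd s \<Longrightarrow> \<not> s' dvd 1 \<Longrightarrow> ideal_gen {s', a} \<noteq> UNIV"
    unfolding feckly_zero_adequate_ring_def feckly_adequate_def by (metis diff_0)
  \<comment> \<open>The radical enters only in this form: \<open>r * s\<close> vanishes modulo every
    maximal ideal.\<close>
  then have J: "- (r * s) \<in> M" if "maximal_ring_ideal M" for M
    using that unfolding jacobson_radical_def by blast
  obtain p q where pq: "p * r + q * a = 1" using ra unfolding ideal_gen_pair_eq_UNIV by blast
  have "(a + b * r) dvd 1"
  proof (rule ccontr)
    assume "\<not> (a + b * r) dvd 1"
    then obtain M where M: "maximal_ring_ideal M" and abr: "a + b * r \<in> M"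
      by (rule nonunit_in_maximal_ring_ideal)
    note add = maximal_ring_ideal_add[OF M] and mult = maximal_ring_ideal_mult[OF M]
    have one: "1 \<notin> M"
      using M ring_ideal_one_mem unfolding maximal_ring_ideal_def by blast
    \<comment> \<open>Otherwise \<open>a\<close> would lie in \<open>M\<close> too, against
      \<open>p * r + q * a = 1\<close>.\<close>
    have "r \<notin> M"
    proof
      assume r: "r \<in> M"
      have "a \<in> M" using add[OF abr mult[OF r, of "- b"]] by simp
      then show False using pq add mult r one by metis
    qed
    moreover have "r * s \<in> M" using mult[OF J[OF M], of "- 1"] by simp
    ultimately have sM: "s \<in> M" using maximal_ring_ideal_prime[OF M] by blast
    \<comment> \<open>If \<open>a\<close> were invertible modulo \<open>M\<close>, with
      \<open>m + z * a = 1\<close>, then a gcd \<open>d\<close> of \<open>m\<close> and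
      \<open>s\<close> would be a non-unit divisor of \<open>s\<close> comaximal with
      \<open>a\<close>.\<close>
    have "a \<in> M"
    proof (rule ccontr)
      assume "a \<notin> M"
      then obtain m z where m: "m \<in> M" "m + z * a = 1"
        using maximal_ring_ideal_coprime[OF M] by blast
      obtain d e f where d: "d dvd m" "d dvd s" "d = e * m + f * s"
        using bezout_ring_gcd[OF bez] by blast
      have dM: "d \<in> M" unfolding d(3) by (intro add mult m(1) sM)
      have "\<not> d dvd 1"
        using mult[OF dM] one by (metis dvdE mult.commute)
      moreover have "ideal_gen {d, a} = UNIV"
        unfolding ideal_gen_pair_eq_UNIV using m(2) d(1) by (metis dvdE mult.commute)
      ultimately show False using s d(2) by blast
    qed
    \<comment> \<open>As \<open>r\<close> lies outside \<open>M\<close>, primality puts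
      \<open>b\<close> in \<open>M\<close> as well, against
      \<open>x * a + y * b = 1\<close>.\<close>
    then have "b * r \<in> M" using add[OF abr mult[of a "- 1"]] by simp
    then have "b \<in> M" using maximal_ring_ideal_prime[OF M, of r b] \<open>r \<notin> M\<close> by (simp add: mult.commute)
    then show False using ab add mult \<open>a \<in> M\<close> one by metis
  qed
  then show ?thesis by blast
qed

text \<open>Every common divisor of \<open>a\<close> and \<open>b\<close> divides
  \<open>a + b * z\<close>, so this element is a gcd in which \<open>a\<close> has coefficient 1.
  The matrix argument uses nothing else about the ring.\<close>

definition gcd_additive :: "'a::comm_ring_1 itself \<Rightarrow> bool" where
  "gcd_additive _ \<longleftrightarrow> (\<forall>a b :: 'a. \<exists>z. (a + b * z) dvd a \<and> (a + b * z) dvd b)"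

text \<open>Stable range one, applied to the cofactors of \<open>a\<close> and \<open>b\<close> in
  their gcd \<open>d\<close>, yields a unit; \<open>d\<close> times this unit has the form
  \<open>a + b * z\<close> and divides \<open>d\<close>.\<close>

lemma feckly_zero_adequate_imp_gcd_additive:
  assumes R: "feckly_zero_adequate_ring TYPE('a::comm_ring_1)"
  shows "gcd_additive TYPE('a)"
  unfolding gcd_additive_def
proof (intro allI)
  fix a b :: 'a
  have bez: "bezout_ring TYPE('a)" using R by (simp add: feckly_zero_adequate_ring_def)
  obtain d x y where "d dvd a" "d dvd b" and d: "d = x * a + y * b"
    using bezout_ring_gcd[OF bez] .
  then obtain a' b' where a': "a = d * a'" and b': "b = d * b'" unfolding dvd_def by blast
  \<comment> \<open>\<open>d\<close> may be a zero divisor, so \<open>a'\<close> and \<open>b'\<close> need not be comaximal; the annihilator element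
    \<open>k\<close> repairs this.\<close>
  define k where "k = 1 - x * a' - y * b'"
  have dk: "d * k = 0"
  proof -
    have "d * k = d - (x * (d * a') + y * (d * b'))" by (simp add: k_def algebra_simps)
    also have "\<dots> = 0" unfolding a'[symmetric] b'[symmetric] by (simp add: d)
    finally show ?thesis .
  qed
  have "x * a' + 1 * (y * b' + k) = 1" by (simp add: k_def)
  from stable_range_one[OF R this] obtain t where t: "(a' + (y * b' + k) * t) dvd 1" ..
  \<comment> \<open>Multiplication by \<open>d\<close> kills the term with \<open>k\<close>.\<close>
  have "d * (a' + (y * b' + k) * t) = d * a' + d * b' * (y * t) + d * k * t"
    by (simp add: algebra_simps)
  also have "\<dots> = a + b * (y * t)" using dk a' b' by simp
  finally have "d * (a' + (y * b' + k) * t) = a + b * (y * t)" .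
  moreover have "d * (a' + (y * b' + k) * t) dvd d" using mult_dvd_mono[OF dvd_refl t, of d] by simp
  ultimately have "(a + b * (y * t)) dvd d" by simp
  then show "\<exists>z. (a + b * z) dvd a \<and> (a + b * z) dvd b"
    using \<open>d dvd a\<close> \<open>d dvd b\<close> dvd_trans by blast
qed

section \<open>Compressing the content of a matrix\<close>

text \<open>Each new \<open>c k\<close> is absorbed by one use of \<open>gcd_additive\<close> with
  the sum so far as first argument. The coefficient of \<open>a\<close> stays 1, as a transvection
  requires.\<close>

lemma gcd_additive_sum:
  fixes a :: "'a::comm_ring_1"
  assumes R: "gcd_additive TYPE('a)" and "finite J"
  shows "\<exists>z. (a + (\<Sum>j\<in>J. c j * z j)) dvd a \<and> (\<forall>j\<in>J. (a + (\<Sum>j\<in>J. c j * z j)) dvd c j)"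
  using \<open>finite J\<close>
proof induction
  case empty
  then show ?case by simp
next
  case (insert k J)
  then obtain z where z: "(a + (\<Sum>j\<in>J. c j * z j)) dvd a"
    "\<And>j. j \<in> J \<Longrightarrow> (a + (\<Sum>j\<in>J. c j * z j)) dvd c j" by blast
  let ?h = "a + (\<Sum>j\<in>J. c j * z j)"
  obtain t where t: "(?h + c k * t) dvd ?h" "(?h + c k * t) dvd c k"
    using R unfolding gcd_additive_def by blast
  let ?z = "z(k := t)"
  have "(\<Sum>j\<in>J. c j * ?z j) = (\<Sum>j\<in>J. c j * z j)"
    using insert by (intro sum.cong) auto
  then have *: "a + (\<Sum>j\<in>insert k J. c j * ?z j) = ?h + c k * t"
    using insert by (simp add: algebra_simps)
  show ?case
    using z t by (intro exI[of _ ?z], unfold *) (auto intro: dvd_trans)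
qed

text \<open>A column operation turns \<open>b\<close> into \<open>(\<beta>, 0, \<dots>, 0)\<close>; then \<open>t\<close> only has to make the first entry
  of \<open>a + t b\<close>, up to the other entries, a common divisor of everything.\<close>

lemma common_divisors_combine_two_rows:
  fixes a b :: "'b \<Rightarrow> 'a::comm_ring_1"
  assumes R: "gcd_additive TYPE('a)" and J: "finite J"
  shows "\<exists>t. \<forall>d. (\<forall>j\<in>J. d dvd a j + t * b j) \<longrightarrow> (\<forall>j\<in>J. d dvd a j \<and> d dvd b j)"
proof -
  \<comment> \<open>With 0 as the additive start, the sum itself is a gcd of the entries of
    \<open>b\<close>.\<close>
  obtain v where v: "\<And>j. j \<in> J \<Longrightarrow> (\<Sum>j\<in>J. b j * v j) dvd b j"
    using gcd_additive_sum[OF R J, of 0 b] by auto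
  define \<beta> where "\<beta> = (\<Sum>j\<in>J. b j * v j)"
  \<comment> \<open>The column combination \<open>v\<close> that sends \<open>b\<close> to \<beta>
    sends \<open>a\<close> to \<alpha>.\<close>
  define \<alpha> where "\<alpha> = (\<Sum>j\<in>J. a j * v j)"
  from v have "\<forall>j\<in>J. \<exists>w. b j = \<beta> * w" unfolding \<beta>_def dvd_def by blast
  then obtain w where w: "\<And>j. j \<in> J \<Longrightarrow> b j = \<beta> * w j" by metis
  \<comment> \<open>Subtracting \<open>w j\<close> times the combined column from column
    \<open>j\<close> turns \<open>b j\<close> into 0 and \<open>a j\<close> into
    \<open>c j\<close>.\<close>
  define c where "c j = a j - w j * \<alpha>" for j
  obtain u where u: "(\<alpha> + (\<Sum>j\<in>J. c j * u j)) dvd \<alpha>"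
    "\<And>j. j \<in> J \<Longrightarrow> (\<alpha> + (\<Sum>j\<in>J. c j * u j)) dvd c j"
    using gcd_additive_sum[OF R J, of \<alpha> c] by blast
  define h where "h = \<alpha> + (\<Sum>j\<in>J. c j * u j)"
  \<comment> \<open>Adding \<open>t\<close> times the second row changes only \<alpha>, not the
    \<open>c j\<close>; hence it changes \<open>h\<close> to \<open>h + \<beta> * t\<close>.\<close>
  obtain t where t: "(h + \<beta> * t) dvd h" "(h + \<beta> * t) dvd \<beta>"
    using R unfolding gcd_additive_def by blast
  have "d dvd a j \<and> d dvd b j" if d: "\<And>j. j \<in> J \<Longrightarrow> d dvd a j + t * b j" and j: "j \<in> J" for d j
  proof -
    have "(\<Sum>j\<in>J. (a j + t * b j) * v j) = \<alpha> + \<beta> * t"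
      by (simp add: \<alpha>_def \<beta>_def sum.distrib sum_distrib_left sum_distrib_right algebra_simps)
    moreover have "d dvd (\<Sum>j\<in>J. (a j + t * b j) * v j)"
      using d by (intro dvd_sum) auto
    ultimately have d1: "d dvd \<alpha> + \<beta> * t" by simp
    have d2: "d dvd c j" if "j \<in> J" for j
    proof -
      \<comment> \<open>The terms in \<open>t\<close> cancel because
        \<open>b j = \<beta> * w j\<close>.\<close>
      have "c j = (a j + t * b j) - w j * (\<alpha> + \<beta> * t)"
        using w[OF that] by (simp add: c_def algebra_simps)
      then show ?thesis using d[OF that] d1 by (simp add: dvd_diff)
    qed
    have "h + \<beta> * t = (\<alpha> + \<beta> * t) + (\<Sum>j\<in>J. c j * u j)" by (simp add: h_def)
    moreover have "d dvd (\<Sum>j\<in>J. c j * u j)" using d2 by (intro dvd_sum) auto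
    ultimately have g: "d dvd h + \<beta> * t" using d1 by (simp only: dvd_add)
    then have "d dvd h" "d dvd \<beta>" using t dvd_trans by blast+
    then have "d dvd \<alpha>" "d dvd b j" using u(1) w[OF j] dvd_trans h_def by auto
    moreover have "a j = c j + w j * \<alpha>" by (simp add: c_def)
    ultimately show ?thesis using d2[OF j] by simp
  qed
  then show ?thesis by blast
qed

text \<open>The first row plus the rows combined so far serves as first row in the two-row lemma.
  Quantifying over all \<open>d\<close> lets the steps be chained.\<close>

lemma common_divisors_combine_rows:
  fixes a :: "'b \<Rightarrow> 'a::comm_ring_1"
  assumes R: "gcd_additive TYPE('a)" and J: "finite J" and "finite I"
  shows "\<exists>u. \<forall>d. (\<forall>j\<in>J. d dvd a j + (\<Sum>i\<in>I. u i * A i j)) \<longrightarrow>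
    (\<forall>j\<in>J. d dvd a j \<and> (\<forall>i\<in>I. d dvd A i j))"
  using \<open>finite I\<close>
proof induction
  case empty
  then show ?case by simp
next
  case (insert k I)
  then obtain u where u: "\<And>d. (\<forall>j\<in>J. d dvd a j + (\<Sum>i\<in>I. u i * A i j)) \<Longrightarrow>
    (\<forall>j\<in>J. d dvd a j \<and> (\<forall>i\<in>I. d dvd A i j))" by blast
  obtain t where t: "\<And>d. (\<forall>j\<in>J. d dvd (a j + (\<Sum>i\<in>I. u i * A i j)) + t * A k j) \<Longrightarrow>
     (\<forall>j\<in>J. d dvd (a j + (\<Sum>i\<in>I. u i * A i j)) \<and> d dvd A k j)"
    using common_divisors_combine_two_rows[OF R J, of "\<lambda>j. a j + (\<Sum>i\<in>I. u i * A i j)" "A k"]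
    by blast
  let ?u = "u(k := t)"
  have *: "a j + (\<Sum>i\<in>insert k I. ?u i * A i j) = (a j + (\<Sum>i\<in>I. u i * A i j)) + t * A k j" for j
  proof -
    have "(\<Sum>i\<in>I. ?u i * A i j) = (\<Sum>i\<in>I. u i * A i j)"
      using insert by (intro sum.cong) auto
    then show ?thesis using insert by (simp add: algebra_simps)
  qed
  show ?case
    unfolding insert_iff using u t by (intro exI[of _ ?u]) (unfold *, blast)
qed

section \<open>Equivalence of matrices\<close>

definition inv_mats :: "nat \<Rightarrow> 'a::comm_ring_1 mat set" where
  "inv_mats n = {P \<in> carrier_mat n n. invertible_mat P}"

lemma inv_matsI:
  assumes "P \<in> carrier_mat n n" "Q \<in> carrier_mat n n" "P * Q = 1\<^sub>m n" "Q * P = 1\<^sub>m n"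
  shows "P \<in> inv_mats n"
  using assms unfolding inv_mats_def invertible_mat_def inverts_mat_def by auto

lemma inv_matsE:
  assumes "P \<in> inv_mats n"
  obtains Q where "P \<in> carrier_mat n n" "Q \<in> carrier_mat n n" "P * Q = 1\<^sub>m n" "Q * P = 1\<^sub>m n"
proof -
  from assms obtain Q where P: "P \<in> carrier_mat n n"
    and Q: "P * Q = 1\<^sub>m n" "Q * P = 1\<^sub>m (dim_row Q)"
    unfolding inv_mats_def invertible_mat_def inverts_mat_def by auto
  \<comment> \<open>The definition of an inverse leaves the size of \<open>Q\<close> open:
    \<open>P * Q\<close> fixes its columns, \<open>Q * P\<close> its rows.\<close>
  have "Q \<in> carrier_mat n n"
    using arg_cong[OF Q(1), of dim_col] arg_cong[OF Q(2), of dim_col] P by auto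
  with P Q that show thesis by auto
qed

lemma inv_mats_one: "1\<^sub>m n \<in> inv_mats n"
  by (rule inv_matsI[of _ _ "1\<^sub>m n"]) auto

lemma inv_mats_mult:
  assumes "P \<in> inv_mats n" "Q \<in> inv_mats n"
  shows "P * Q \<in> inv_mats n"
proof -
  obtain P' where P: "P \<in> carrier_mat n n" "P' \<in> carrier_mat n n" "P * P' = 1\<^sub>m n" "P' * P = 1\<^sub>m n"
    using assms(1) by (rule inv_matsE)
  obtain Q' where Q: "Q \<in> carrier_mat n n" "Q' \<in> carrier_mat n n" "Q * Q' = 1\<^sub>m n" "Q' * Q = 1\<^sub>m n"
    using assms(2) by (rule inv_matsE)
  have "(P * Q) * (Q' * P') = P * (Q * Q') * P'"
    using P(1,2) Q(1,2) by (smt (verit) assoc_mult_mat mult_carrier_mat)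
  moreover have "(Q' * P') * (P * Q) = Q' * (P' * P) * Q"
    using P(1,2) Q(1,2) by (smt (verit) assoc_mult_mat mult_carrier_mat)
  ultimately show ?thesis
    using P Q by (intro inv_matsI[of _ _ "Q' * P'"]) auto
qed

lemma mult_block_diag:
  assumes "G \<in> carrier_mat k k" "H \<in> carrier_mat k k" "X \<in> carrier_mat m l" "Y \<in> carrier_mat l n"
  shows "four_block_mat G (0\<^sub>m k l) (0\<^sub>m m k) X * four_block_mat H (0\<^sub>m k n) (0\<^sub>m l k) Y
    = four_block_mat (G * H) (0\<^sub>m k n) (0\<^sub>m m k) (X * Y)"
  using assms by (subst mult_four_block_mat[of _ k k _ l _ m _ _ k _ n]) auto

lemma four_block_carrier_mat_Suc:
  assumes "G \<in> carrier_mat 1 1" "A \<in> carrier_mat m n"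
  shows "four_block_mat G B C A \<in> carrier_mat (Suc m) (Suc n)"
  using four_block_carrier_mat[OF assms] by simp

lemma inv_mats_block:
  fixes P :: "'a::comm_ring_1 mat"
  assumes "P \<in> inv_mats n"
  shows "four_block_mat (1\<^sub>m 1) (0\<^sub>m 1 n) (0\<^sub>m n 1) P \<in> inv_mats (Suc n)"
proof -
  obtain Q where P: "P \<in> carrier_mat n n" "Q \<in> carrier_mat n n" "P * Q = 1\<^sub>m n" "Q * P = 1\<^sub>m n"
    using assms by (rule inv_matsE)
  let ?B = "\<lambda>P :: 'a mat. four_block_mat (1\<^sub>m 1) (0\<^sub>m 1 n) (0\<^sub>m n 1) P"
  have mult: "?B X * ?B Y = ?B (X * Y)" if "X \<in> carrier_mat n n" "Y \<in> carrier_mat n n" for X Y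
    by (simp only: mult_block_diag[OF one_carrier_mat one_carrier_mat that]
      left_mult_one_mat[OF one_carrier_mat])
  have one: "?B (1\<^sub>m n) = 1\<^sub>m (Suc n)"
    by (simp only: four_block_one_mat plus_1_eq_Suc)
  show ?thesis
  proof (rule inv_matsI)
    show "?B P \<in> carrier_mat (Suc n) (Suc n)" "?B Q \<in> carrier_mat (Suc n) (Suc n)"
      by (intro four_block_carrier_mat_Suc one_carrier_mat P)+
    show "?B P * ?B Q = 1\<^sub>m (Suc n)" "?B Q * ?B P = 1\<^sub>m (Suc n)"
      by (simp_all only: mult P one)
  qed
qed

definition equivalent_mats :: "'a::comm_ring_1 mat \<Rightarrow> 'a mat \<Rightarrow> bool" where
  "equivalent_mats A B \<longleftrightarrow>
    (\<exists>P \<in> inv_mats (dim_row A). \<exists>Q \<in> inv_mats (dim_col A). B = P * A * Q)"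

lemma equivalent_matsI:
  assumes "A \<in> carrier_mat m n" "P \<in> inv_mats m" "Q \<in> inv_mats n"
  shows "equivalent_mats A (P * A * Q)"
  using assms unfolding equivalent_mats_def by auto

lemma equivalent_matsE:
  assumes "equivalent_mats A B" "A \<in> carrier_mat m n"
  obtains P Q where "P \<in> inv_mats m" "Q \<in> inv_mats n" "B = P * A * Q"
    "P \<in> carrier_mat m m" "Q \<in> carrier_mat n n" "B \<in> carrier_mat m n"
proof -
  obtain P Q where PQ: "P \<in> inv_mats m" "Q \<in> inv_mats n" "B = P * A * Q"
    using assms unfolding equivalent_mats_def by auto
  moreover have "P \<in> carrier_mat m m" "Q \<in> carrier_mat n n"
    using PQ unfolding inv_mats_def by auto
  ultimately show thesis using that assms(2) by auto
qed

lemma equivalent_mats_refl: "equivalent_mats A A"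
  using equivalent_matsI[OF _ inv_mats_one inv_mats_one, of A "dim_row A" "dim_col A"] by simp

lemma equivalent_mats_trans [trans]:
  assumes "equivalent_mats A B" "equivalent_mats B C"
  shows "equivalent_mats A C"
proof -
  let ?m = "dim_row A" and ?n = "dim_col A"
  have A: "A \<in> carrier_mat ?m ?n" by simp
  obtain P Q where PQ: "P \<in> inv_mats ?m" "Q \<in> inv_mats ?n" "B = P * A * Q"
    "P \<in> carrier_mat ?m ?m" "Q \<in> carrier_mat ?n ?n" and B: "B \<in> carrier_mat ?m ?n"
    using equivalent_matsE[OF assms(1) A] .
  obtain P' Q' where PQ': "P' \<in> inv_mats ?m" "Q' \<in> inv_mats ?n" "C = P' * B * Q'"
    "P' \<in> carrier_mat ?m ?m" "Q' \<in> carrier_mat ?n ?n"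
    using equivalent_matsE[OF assms(2) B] .
  have "C = (P' * P) * A * (Q * Q')"
    unfolding PQ'(3) PQ(3) using PQ(4,5) PQ'(4,5) A
    by (smt (verit) assoc_mult_mat mult_carrier_mat)
  then show ?thesis
    using equivalent_matsI[OF A inv_mats_mult[OF PQ'(1) PQ(1)] inv_mats_mult[OF PQ(2) PQ'(2)]] by simp
qed

lemma dvd_mult_mat:
  fixes A B :: "'a::comm_ring_1 mat"
  assumes "A \<in> carrier_mat m k" "B \<in> carrier_mat k n" "i < m" "j < n"
    and "(\<forall>l<k. d dvd A $$ (i, l)) \<or> (\<forall>l<k. d dvd B $$ (l, j))"
  shows "d dvd (A * B) $$ (i, j)"
  using assms by (auto simp: scalar_prod_def intro!: dvd_sum)

text \<open>Entries of \<open>P * A * Q\<close> are linear combinations of entries of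
  \<open>A\<close>, so a common divisor such as the corner survives later reductions.\<close>

lemma equivalent_mats_dvd:
  fixes A B :: "'a::comm_ring_1 mat"
  assumes "equivalent_mats A B" "A \<in> carrier_mat m n"
    and d: "\<And>i j. i < m \<Longrightarrow> j < n \<Longrightarrow> d dvd A $$ (i, j)" and ij: "i < m" "j < n"
  shows "d dvd B $$ (i, j)"
proof -
  obtain P Q where B: "B = P * A * Q" and P: "P \<in> carrier_mat m m" and Q: "Q \<in> carrier_mat n n"
    using equivalent_matsE[OF assms(1,2)] .
  have PA: "d dvd (P * A) $$ (i, l)" if "l < n" for l
    using dvd_mult_mat[OF P assms(2) \<open>i < m\<close> that] d that by blast
  have "P * A \<in> carrier_mat m n" using P assms(2) by simp
  from dvd_mult_mat[OF this Q ij] PA show ?thesis unfolding B by blast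
qed

text \<open>Bordering \<open>P\<close> and \<open>Q\<close> by a 1 reduces the lower block while the
  corner \<open>g\<close> stays fixed.\<close>

lemma equivalent_mats_block:
  assumes "equivalent_mats A B" "A \<in> carrier_mat m n"
  shows "equivalent_mats (four_block_mat (g \<cdot>\<^sub>m 1\<^sub>m 1) (0\<^sub>m 1 n) (0\<^sub>m m 1) A)
    (four_block_mat (g \<cdot>\<^sub>m 1\<^sub>m 1) (0\<^sub>m 1 n) (0\<^sub>m m 1) B)"
proof -
  obtain P Q where PQ: "P \<in> inv_mats m" "Q \<in> inv_mats n" "B = P * A * Q"
    "P \<in> carrier_mat m m" "Q \<in> carrier_mat n n"
    using equivalent_matsE[OF assms] .
  let ?P = "four_block_mat (1\<^sub>m 1) (0\<^sub>m 1 m) (0\<^sub>m m 1) P"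
  let ?Q = "four_block_mat (1\<^sub>m 1) (0\<^sub>m 1 n) (0\<^sub>m n 1) Q"
  let ?A = "four_block_mat (g \<cdot>\<^sub>m 1\<^sub>m 1) (0\<^sub>m 1 n) (0\<^sub>m m 1) A"
  have G: "g \<cdot>\<^sub>m 1\<^sub>m 1 \<in> carrier_mat 1 1" by simp
  have "?P * ?A * ?Q = four_block_mat (g \<cdot>\<^sub>m 1\<^sub>m 1) (0\<^sub>m 1 n) (0\<^sub>m m 1) B"
    unfolding PQ(3) mult_block_diag[OF one_carrier_mat G PQ(4) assms(2)] left_mult_one_mat[OF G]
      mult_block_diag[OF G one_carrier_mat mult_carrier_mat[OF PQ(4) assms(2)] PQ(5)]
      right_mult_one_mat[OF G] ..
  then show ?thesis
    using equivalent_matsI[OF four_block_carrier_mat_Suc[OF G assms(2)]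
      inv_mats_block[OF PQ(1)] inv_mats_block[OF PQ(2)]] by metis
qed

section \<open>Transvections along the first row and the first column\<close>

text \<open>The corner is 1 whatever \<open>u 0\<close> is. On the left this matrix collects
  multiples of the lower rows in the first row; on the right it spreads multiples of the first
  column, which clears entries. For \<open>col_transvection\<close> the two sides trade
  roles.\<close>

definition row_transvection :: "nat \<Rightarrow> (nat \<Rightarrow> 'a) \<Rightarrow> 'a::comm_ring_1 mat" where
  "row_transvection n u =
    mat n n (\<lambda>(i, j). if i = j then 1 else if i = 0 then u j else 0)"

definition col_transvection :: "nat \<Rightarrow> (nat \<Rightarrow> 'a) \<Rightarrow> 'a::comm_ring_1 mat" where
  "col_transvection n u =
    mat n n (\<lambda>(i, j). if i = j then 1 else if j = 0 then u i else 0)"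

lemma transvection_carrier [simp]:
  "row_transvection n u \<in> carrier_mat n n" "col_transvection n u \<in> carrier_mat n n"
  by (simp_all add: row_transvection_def col_transvection_def)

lemma row_transvection_mult:
  assumes "A \<in> carrier_mat m n" "i < m" "j < n"
  shows "(row_transvection m u * A) $$ (i, j) =
    (if i = 0 then A $$ (0, j) + (\<Sum>k=1..<m. u k * A $$ (k, j)) else A $$ (i, j))"
proof -
  have "(row_transvection m u * A) $$ (i, j) =
    (\<Sum>k=0..<m. (if i = k then 1 else if i = 0 then u k else 0) * A $$ (k, j))"
    using assms by (auto simp: row_transvection_def scalar_prod_def)
  \<comment> \<open>The diagonal term is split off; for nonzero \<open>i\<close> the rest
    vanishes.\<close>
  also have "\<dots> = A $$ (i, j) + (\<Sum>k\<in>{0..<m} - {i}. (if i = 0 then u k else 0) * A $$ (k, j))"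
    using assms by (subst sum.remove[of _ i]) (auto intro!: sum.cong)
  also have "\<dots> = (if i = 0 then A $$ (0, j) + (\<Sum>k=1..<m. u k * A $$ (k, j)) else A $$ (i, j))"
    by (auto intro!: sum.cong)
  finally show ?thesis .
qed

lemma mult_col_transvection:
  assumes "A \<in> carrier_mat m n" "i < m" "j < n"
  shows "(A * col_transvection n u) $$ (i, j) =
    (if j = 0 then A $$ (i, 0) + (\<Sum>k=1..<n. A $$ (i, k) * u k) else A $$ (i, j))"
proof -
  have "(A * col_transvection n u) $$ (i, j) =
    (\<Sum>k=0..<n. A $$ (i, k) * (if k = j then 1 else if j = 0 then u k else 0))"
    using assms by (auto simp: col_transvection_def scalar_prod_def)
  also have "\<dots> = A $$ (i, j) + (\<Sum>k\<in>{0..<n} - {j}. A $$ (i, k) * (if j = 0 then u k else 0))"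
    using assms by (subst sum.remove[of _ j]) (auto intro!: sum.cong)
  also have "\<dots> = (if j = 0 then A $$ (i, 0) + (\<Sum>k=1..<n. A $$ (i, k) * u k) else A $$ (i, j))"
    by (auto intro!: sum.cong)
  finally show ?thesis .
qed

lemma col_transvection_mult:
  assumes "A \<in> carrier_mat m n" "i < m" "j < n"
  shows "(col_transvection m u * A) $$ (i, j) =
    (if i = 0 then A $$ (0, j) else A $$ (i, j) + u i * A $$ (0, j))"
proof -
  have "(col_transvection m u * A) $$ (i, j) =
    (\<Sum>k=0..<m. (if i = k then 1 else if k = 0 then u i else 0) * A $$ (k, j))"
    using assms by (auto simp: col_transvection_def scalar_prod_def)
  also have "\<dots> = A $$ (i, j) + (\<Sum>k\<in>{0..<m} - {i}. if k = 0 then u i * A $$ (k, j) else 0)"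
    using assms
    by (subst sum.remove[of _ i], simp, simp, intro arg_cong2[of _ _ _ _ "(+)"] sum.cong) auto
  also have "\<dots> = (if i = 0 then A $$ (0, j) else A $$ (i, j) + u i * A $$ (0, j))"
    using assms by (auto simp: sum.delta)
  finally show ?thesis .
qed

lemma mult_row_transvection:
  assumes "A \<in> carrier_mat m n" "i < m" "j < n"
  shows "(A * row_transvection n u) $$ (i, j) =
    (if j = 0 then A $$ (i, 0) else A $$ (i, j) + A $$ (i, 0) * u j)"
proof -
  have "(A * row_transvection n u) $$ (i, j) =
    (\<Sum>k=0..<n. A $$ (i, k) * (if k = j then 1 else if k = 0 then u j else 0))"
    using assms by (auto simp: row_transvection_def scalar_prod_def)
  also have "\<dots> = A $$ (i, j) + (\<Sum>k\<in>{0..<n} - {j}. if k = 0 then A $$ (i, k) * u j else 0)"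
    using assms
    by (subst sum.remove[of _ j], simp, simp, intro arg_cong2[of _ _ _ _ "(+)"] sum.cong) auto
  also have "\<dots> = (if j = 0 then A $$ (i, 0) else A $$ (i, j) + A $$ (i, 0) * u j)"
    using assms by (auto simp: sum.delta)
  finally show ?thesis .
qed

lemma row_transvection_inv: "row_transvection n u \<in> inv_mats n"
proof -
  have "row_transvection n u * row_transvection n (\<lambda>j. - u j) = 1\<^sub>m n" for u :: "nat \<Rightarrow> 'a"
  proof (rule eq_matI)
    fix i j assume "i < dim_row (1\<^sub>m n :: 'a mat)" "j < dim_col (1\<^sub>m n :: 'a mat)"
    then show "(row_transvection n u * row_transvection n (\<lambda>j. - u j)) $$ (i, j) = 1\<^sub>m n $$ (i, j)"
      by (subst mult_row_transvection[of _ n n]) (auto simp: row_transvection_def)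
  qed (auto simp: row_transvection_def)
  \<comment> \<open>The instance at \<open>- u\<close> is the product in the opposite order, since
    the two negations cancel.\<close>
  from this[of u] this[of "\<lambda>j. - u j"] show ?thesis
    by (intro inv_matsI[of _ _ "row_transvection n (\<lambda>j. - u j)"]) auto
qed

lemma col_transvection_inv: "col_transvection n u \<in> inv_mats n"
proof -
  have "col_transvection n u * col_transvection n (\<lambda>j. - u j) = 1\<^sub>m n" for u :: "nat \<Rightarrow> 'a"
  proof (rule eq_matI)
    fix i j assume "i < dim_row (1\<^sub>m n :: 'a mat)" "j < dim_col (1\<^sub>m n :: 'a mat)"
    then show "(col_transvection n u * col_transvection n (\<lambda>j. - u j)) $$ (i, j) = 1\<^sub>m n $$ (i, j)"
      by (subst col_transvection_mult[of _ n n]) (auto simp: col_transvection_def)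
  qed (auto simp: col_transvection_def)
  from this[of u] this[of "\<lambda>j. - u j"] show ?thesis
    by (intro inv_matsI[of _ _ "col_transvection n (\<lambda>j. - u j)"]) auto
qed

section \<open>Diagonal reduction\<close>

text \<open>Two compressions: \<open>u\<close> gathers the rows in the first row, then
  \<open>z\<close> gathers that row in its first entry.\<close>

lemma content_to_corner:
  fixes A :: "'a::comm_ring_1 mat"
  assumes R: "gcd_additive TYPE('a)" and A: "A \<in> carrier_mat (Suc m) (Suc n)"
  obtains B where "equivalent_mats A B"
    "\<And>i j. i < Suc m \<Longrightarrow> j < Suc n \<Longrightarrow> B $$ (0, 0) dvd B $$ (i, j)"
proof -
  obtain u where u: "\<And>d j i. (\<And>j. j < Suc n \<Longrightarrow> d dvd A $$ (0, j) + (\<Sum>i=1..<Suc m. u i * A $$ (i, j))) \<Longrightarrow>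
    j < Suc n \<Longrightarrow> d dvd A $$ (0, j) \<and> (1 \<le> i \<and> i < Suc m \<longrightarrow> d dvd A $$ (i, j))"
    using common_divisors_combine_rows[OF R, of "{..<Suc n}" "{1..<Suc m}" "\<lambda>j. A $$ (0, j)" "\<lambda>i j. A $$ (i, j)"]
    unfolding Ball_def lessThan_iff atLeastLessThan_iff by blast
  define c where "c j = A $$ (0, j) + (\<Sum>i=1..<Suc m. u i * A $$ (i, j))" for j
  obtain z where z: "(c 0 + (\<Sum>j=1..<Suc n. c j * z j)) dvd c 0"
    "\<And>j. j \<in> {1..<Suc n} \<Longrightarrow> (c 0 + (\<Sum>j=1..<Suc n. c j * z j)) dvd c j"
    using gcd_additive_sum[OF R, of "{1..<Suc n}" "c 0" c] by blast
  define g where "g = c 0 + (\<Sum>j=1..<Suc n. c j * z j)"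
  have gc: "g dvd c j" if "j < Suc n" for j
    using z that unfolding g_def by (cases "j = 0") auto
  \<comment> \<open>Since \<open>g\<close> divides the whole combined row \<open>c\<close>, the
    choice of \<open>u\<close> makes it divide every entry of \<open>A\<close>.\<close>
  have gA: "g dvd A $$ (i, j)" if "i < Suc m" "j < Suc n" for i j
    using u[of g j i, OF gc[unfolded c_def] that(2)] that(1) by (cases "i = 0") auto
  define B where "B = row_transvection (Suc m) u * A * col_transvection (Suc n) z"
  have AB: "equivalent_mats A B"
    unfolding B_def by (rule equivalent_matsI[OF A row_transvection_inv col_transvection_inv])
  have RA: "row_transvection (Suc m) u * A \<in> carrier_mat (Suc m) (Suc n)"
    using A by (rule mult_carrier_mat[OF transvection_carrier(1)])
  have "(row_transvection (Suc m) u * A) $$ (0, j) = c j" if "j < Suc n" for j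
    using row_transvection_mult[OF A _ that, of 0 u] by (simp add: c_def)
  then have "B $$ (0, 0) = g"
    unfolding B_def g_def using mult_col_transvection[OF RA, of 0 0 z]
    by (simp del: sum.op_ivl_Suc)
  then have "B $$ (0, 0) dvd B $$ (i, j)" if "i < Suc m" "j < Suc n" for i j
    using equivalent_mats_dvd[OF AB A gA that] by simp
  with AB that show thesis by blast
qed

text \<open>The quotients of the first column and row by the corner, negated, are the multipliers of
  the clearing transvections.\<close>

lemma split_corner:
  fixes A :: "'a::comm_ring_1 mat"
  assumes A: "A \<in> carrier_mat (Suc m) (Suc n)"
    and dvd: "\<And>i j. i < Suc m \<Longrightarrow> j < Suc n \<Longrightarrow> A $$ (0, 0) dvd A $$ (i, j)"
  obtains B where "B \<in> carrier_mat m n"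
    "equivalent_mats A (four_block_mat (A $$ (0, 0) \<cdot>\<^sub>m 1\<^sub>m 1) (0\<^sub>m 1 n) (0\<^sub>m m 1) B)"
    "\<And>i j. i < m \<Longrightarrow> j < n \<Longrightarrow> A $$ (0, 0) dvd B $$ (i, j)"
proof -
  let ?g = "A $$ (0, 0)"
  \<comment> \<open>Any quotients will do; with zero divisors even \<open>p 0\<close> may differ
    from 1, but the transvection keeps 1 on its diagonal.\<close>
  have "\<forall>i. \<exists>p. i < Suc m \<longrightarrow> A $$ (i, 0) = ?g * p" using dvd unfolding dvd_def by blast
  then obtain p where p: "\<And>i. i < Suc m \<Longrightarrow> A $$ (i, 0) = ?g * p i" by metis
  have "\<forall>j. \<exists>q. j < Suc n \<longrightarrow> A $$ (0, j) = ?g * q" using dvd unfolding dvd_def by blast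
  then obtain q where q: "\<And>j. j < Suc n \<Longrightarrow> A $$ (0, j) = ?g * q j" by metis
  let ?L = "col_transvection (Suc m) (\<lambda>i. - p i)"
  let ?T = "row_transvection (Suc n) (\<lambda>j. - q j)"
  define C where "C = ?L * A * ?T"
  have AC: "equivalent_mats A C"
    unfolding C_def by (rule equivalent_matsI[OF A col_transvection_inv row_transvection_inv])
  have LA: "?L * A \<in> carrier_mat (Suc m) (Suc n)"
    using A by (rule mult_carrier_mat[OF transvection_carrier(2)])
  have Ccar: "C \<in> carrier_mat (Suc m) (Suc n)"
    unfolding C_def using LA by (rule mult_carrier_mat[OF _ transvection_carrier(1)])
  have L0: "(?L * A) $$ (i, 0) = (if i = 0 then ?g else 0)" if "i < Suc m" for i
    using col_transvection_mult[OF A that, of 0] p[OF that] by simp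
  have C0: "C $$ (i, 0) = (if i = 0 then ?g else 0)" if "i < Suc m" for i
    using mult_row_transvection[OF LA that, of 0] L0[OF that] by (simp add: C_def)
  \<comment> \<open>The left factor leaves row 0 of \<open>A\<close> unchanged, so the quotients
    \<open>q\<close> still fit.\<close>
  have C1: "C $$ (0, j) = 0" if "0 < j" "j < Suc n" for j
    using mult_row_transvection[OF LA _ that(2), of 0] col_transvection_mult[OF A _ that(2), of 0]
      L0[of 0] q[OF that(2)] that by (simp add: C_def)
  define B where "B = mat m n (\<lambda>(i, j). C $$ (Suc i, Suc j))"
  have "C = four_block_mat (?g \<cdot>\<^sub>m 1\<^sub>m 1) (0\<^sub>m 1 n) (0\<^sub>m m 1) B"
    using Ccar by (intro eq_matI) (auto simp: B_def C0 C1 split: if_splits)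
  moreover have "?g dvd B $$ (i, j)" if "i < m" "j < n" for i j
    using equivalent_mats_dvd[OF AC A dvd, of "Suc i" "Suc j"] that by (simp add: B_def)
  moreover have "B \<in> carrier_mat m n" by (simp add: B_def)
  ultimately show thesis using AC that by blast
qed

text \<open>The conditions that \<open>admits_diagonal_reduction\<close> puts on
  \<open>P * A * Q\<close>, detached from \<open>P\<close> and \<open>Q\<close> so that the
  induction can speak of the reduced block alone.\<close>

definition smith_form :: "'a::comm_ring_1 mat \<Rightarrow> bool" where
  "smith_form D \<longleftrightarrow> diagonal_mat D \<and>
    (\<forall>i. Suc i < min (dim_row D) (dim_col D) \<longrightarrow> D $$ (i, i) dvd D $$ (Suc i, Suc i))"

lemma smith_form_block:
  assumes D: "D \<in> carrier_mat m n" "smith_form D"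
    and g: "\<And>i j. i < m \<Longrightarrow> j < n \<Longrightarrow> g dvd D $$ (i, j)"
  shows "smith_form (four_block_mat (g \<cdot>\<^sub>m 1\<^sub>m 1) (0\<^sub>m 1 n) (0\<^sub>m m 1) D)"
proof -
  let ?E = "four_block_mat (g \<cdot>\<^sub>m 1\<^sub>m 1) (0\<^sub>m 1 n) (0\<^sub>m m 1) D"
  have "diagonal_mat ?E"
    using D unfolding smith_form_def diagonal_mat_def by auto
  \<comment> \<open>For \<open>i = 0\<close> the corner meets the first diagonal entry of
    \<open>D\<close>, where \<open>g\<close> applies; later indices are those of \<open>D\<close>
    shifted by one.\<close>
  moreover have "?E $$ (i, i) dvd ?E $$ (Suc i, Suc i)"
    if "Suc i < min (dim_row ?E) (dim_col ?E)" for i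
    using that D g unfolding smith_form_def by (cases i) auto
  ultimately show ?thesis unfolding smith_form_def by blast
qed

text \<open>Rows and columns shrink together, so induction on the rows with \<open>n\<close> and
  \<open>A\<close> general suffices; a matrix without rows or columns is already reduced.\<close>

lemma exists_smith_form:
  fixes A :: "'a::comm_ring_1 mat"
  assumes R: "gcd_additive TYPE('a)" and "A \<in> carrier_mat m n"
  shows "\<exists>D. equivalent_mats A D \<and> smith_form D"
  using assms(2)
proof (induction m arbitrary: n A)
  case 0
  then have "smith_form A" by (auto simp: smith_form_def diagonal_mat_def)
  then show ?case using equivalent_mats_refl by blast
next
  case (Suc m)
  show ?case
  proof (cases n)
    case 0
    with Suc.prems have "smith_form A" by (auto simp: smith_form_def diagonal_mat_def)
    then show ?thesis using equivalent_mats_refl by blast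
  next
    case (Suc k)
    with Suc.prems have A: "A \<in> carrier_mat (Suc m) (Suc k)" by simp
    obtain B where AB: "equivalent_mats A B"
      and B: "\<And>i j. i < Suc m \<Longrightarrow> j < Suc k \<Longrightarrow> B $$ (0, 0) dvd B $$ (i, j)"
      using content_to_corner[OF R A] by blast
    have "B \<in> carrier_mat (Suc m) (Suc k)" using equivalent_matsE[OF AB A] .
    then obtain C where C: "C \<in> carrier_mat m k"
      and BC: "equivalent_mats B (four_block_mat (B $$ (0, 0) \<cdot>\<^sub>m 1\<^sub>m 1) (0\<^sub>m 1 k) (0\<^sub>m m 1) C)"
      and g: "\<And>i j. i < m \<Longrightarrow> j < k \<Longrightarrow> B $$ (0, 0) dvd C $$ (i, j)"
      using split_corner[OF _ B] by blast
    obtain D where CD: "equivalent_mats C D" and D: "smith_form D"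
      using Suc.IH[OF C] by blast
    have "D \<in> carrier_mat m k" using equivalent_matsE[OF CD C] .
    \<comment> \<open>Divisibility by the corner passes from \<open>C\<close> to the equivalent
      matrix \<open>D\<close>.\<close>
    then have "smith_form (four_block_mat (B $$ (0, 0) \<cdot>\<^sub>m 1\<^sub>m 1) (0\<^sub>m 1 k) (0\<^sub>m m 1) D)"
      using smith_form_block[OF _ D] equivalent_mats_dvd[OF CD C g] by blast
    moreover note equivalent_mats_trans[OF equivalent_mats_trans[OF AB BC] equivalent_mats_block[OF CD C]]
    ultimately show ?thesis by blast
  qed
qed

theorem corollary2p6:
  assumes "feckly_zero_adequate_ring TYPE('a::comm_ring_1)"
  shows "elementary_divisor_ring TYPE('a)"
proof -
  note R = feckly_zero_adequate_imp_gcd_additive[OF assms]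
  show ?thesis
    unfolding elementary_divisor_ring_def
  proof
    fix A :: "'a mat"
    have A: "A \<in> carrier_mat (dim_row A) (dim_col A)" by simp
    obtain D where AD: "equivalent_mats A D" and D: "smith_form D"
      using exists_smith_form[OF R A] by blast
    show "admits_diagonal_reduction A"
    proof (rule equivalent_matsE[OF AD A])
      fix P Q
      assume "P \<in> inv_mats (dim_row A)" "Q \<in> inv_mats (dim_col A)" "D = P * A * Q"
        "D \<in> carrier_mat (dim_row A) (dim_col A)"
      then have "P \<in> carrier_mat (dim_row A) (dim_row A)" "invertible_mat P"
        "Q \<in> carrier_mat (dim_col A) (dim_col A)" "invertible_mat Q"
        "dim_row D = dim_row A" "dim_col D = dim_col A" "D = P * A * Q"
        by (auto simp: inv_mats_def)
      with D show ?thesis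
        unfolding admits_diagonal_reduction_def smith_form_def by metis
    qed
  qed
qed

end
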